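(* Let $n\ge 4$ and let $S$ be an inductive strategy of length $n$ with $S\neq CS$, i.e. $S[n]\neq[2,3,\dots,n,1]$. Then $[x^3]f_{CS}(x)>[x^3]f_S(x)$, where $CS$ is the cyclic shift strategy of length $n$.
   Context: Permutation wordle on $[n]=\{1,\dots,n\}$: a secret permutation $\pi\in S_n$ (one-line notation) is fixed. The first guess is $\gamma_1=[1,2,\dots,n]$. After guess $\gamma_r$ the guesser learns $\mathcal{J}_r=\{i:\gamma_r(i)=\pi(i)\}$; $\mathcal{I}_r=[n]\setminus\mathcal{J}_r$. The game ends at the first $r$ with $\mathcal{J}_r=[n]$. A strategy of length $n$ is a sequence $S=(S[1],\dots,S[n])$ with $S[k]$ a permutation of $[k]$; if $\mathcal{I}_r=\{i_1<\dots<i_k\}\neq\emptyset$ and $\sigma=S[k]$, then $\gamma_{r+1}(i)=\gamma_r(i)$ for $i\in\mathcal{J}_r$ and $\gamma_{r+1}(i_{\sigma(j)})=\gamma_r(i_j)$ for $j=1,\dots,k$. $f_S(x)=\sum_r a_rx^r$ where $a_r$ is the number of $\pi\in S_n$ for which the game with $S$ ends after exactly $r$ guesses. The cyclic shift strategy $CS$ has $CS[k]=[2,3,\dots,k,1]$ for every $k$ (with $CS[1]=[1]$). An inductive strategy of length $n$ is a strategy $S$ with $S[k]=CS[k]$ for $1\le k\le n-1$ and $S[n]$ an arbitrary cyclic permutation of $[n]$ (a single $n$-cycle). *)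

theory Defs
  imports "HOL-Combinatorics.Combinatorics" "HOL-Computational_Algebra.Formal_Power_Series"
begin

text \<open>
  A permutation of \<open>[n]\<close> is a function \<open>nat \<Rightarrow> nat\<close> that permutes \<open>{1..n}\<close>, hence is the identity
  elsewhere; one-line notation \<open>[a\<^sub>1, \<dots>, a\<^sub>n]\<close> stands for \<open>i \<mapsto> a\<^sub>i\<close>.

  A strategy of length \<open>n\<close> is an extensional function on \<open>{1..n}\<close>, so that equality of two strategies
  is equality of their \<open>n\<close> entries.
\<close>

definition strategies :: "nat \<Rightarrow> (nat \<Rightarrow> nat \<Rightarrow> nat) set" where
  "strategies n = (\<Pi>\<^sub>E k\<in>{1..n}. {\<sigma>. \<sigma> permutes {1..k}})"

definition cyclic_shift :: "nat \<Rightarrow> nat \<Rightarrow> nat" where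
  "cyclic_shift k i = (if i \<in> {1..k} then if i < k then i + 1 else 1 else i)"

definition CS :: "nat \<Rightarrow> nat \<Rightarrow> nat \<Rightarrow> nat" where
  "CS n = (\<lambda>k\<in>{1..n}. cyclic_shift k)"

definition inductive_strategy :: "nat \<Rightarrow> (nat \<Rightarrow> nat \<Rightarrow> nat) \<Rightarrow> bool" where
  "inductive_strategy n S \<longleftrightarrow>
     S \<in> strategies n \<and> (\<forall>k\<in>{1..<n}. S k = CS n k) \<and> cyclic_on (S n) {1..n}"

definition correct :: "nat \<Rightarrow> (nat \<Rightarrow> nat) \<Rightarrow> (nat \<Rightarrow> nat) \<Rightarrow> nat set" where
  "correct n \<pi> \<gamma> = {i \<in> {1..n}. \<gamma> i = \<pi> i}"

definition incorrect :: "nat \<Rightarrow> (nat \<Rightarrow> nat) \<Rightarrow> (nat \<Rightarrow> nat) \<Rightarrow> nat set" where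
  "incorrect n \<pi> \<gamma> = {1..n} - correct n \<pi> \<gamma>"

text \<open>For \<open>I = {i\<^sub>1 < \<dots> < i\<^sub>k}\<close>, \<open>elt I j\<close> is \<open>i\<^sub>j\<close>, with \<open>j\<close> counted from 1.\<close>

definition elt :: "nat set \<Rightarrow> nat \<Rightarrow> nat" where
  "elt I j = sorted_list_of_set I ! (j - 1)"

text \<open>
  The value of the next guess at \<open>i \<in> I\<close> is \<open>\<gamma> (i\<^sub>j)\<close>, where \<open>j\<close> is the unique index with
  \<open>i = i\<^bsub>\<sigma>(j)\<^esub>\<close>; see \<open>next_guess_incorrect\<close> below.  If nothing is incorrect the guess is kept.
\<close>

definition next_guess ::
    "nat \<Rightarrow> (nat \<Rightarrow> nat \<Rightarrow> nat) \<Rightarrow> (nat \<Rightarrow> nat) \<Rightarrow> (nat \<Rightarrow> nat) \<Rightarrow> nat \<Rightarrow> nat" where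
  "next_guess n S \<pi> \<gamma> i =
     (let I = incorrect n \<pi> \<gamma>; k = card I; \<sigma> = S k in
      if i \<in> I then \<gamma> (elt I (the_inv_into {1..k} (\<lambda>j. elt I (\<sigma> j)) i)) else \<gamma> i)"

text \<open>Guesses are numbered from 1; the value at index 0 is never used.\<close>

primrec guess :: "nat \<Rightarrow> (nat \<Rightarrow> nat \<Rightarrow> nat) \<Rightarrow> (nat \<Rightarrow> nat) \<Rightarrow> nat \<Rightarrow> nat \<Rightarrow> nat" where
  "guess n S \<pi> 0 = id"
| "guess n S \<pi> (Suc r) = (if r = 0 then id else next_guess n S \<pi> (guess n S \<pi> r))"

definition ends_after :: "nat \<Rightarrow> (nat \<Rightarrow> nat \<Rightarrow> nat) \<Rightarrow> (nat \<Rightarrow> nat) \<Rightarrow> nat \<Rightarrow> bool" where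
  "ends_after n S \<pi> r \<longleftrightarrow> r \<ge> 1 \<and> correct n \<pi> (guess n S \<pi> r) = {1..n} \<and>
     (\<forall>q\<in>{1..<r}. correct n \<pi> (guess n S \<pi> q) \<noteq> {1..n})"

definition game_gf :: "nat \<Rightarrow> (nat \<Rightarrow> nat \<Rightarrow> nat) \<Rightarrow> nat fps" where
  "game_gf n S = Abs_fps (\<lambda>r. card {\<pi>. \<pi> permutes {1..n} \<and> ends_after n S \<pi> r})"

lemma next_guess_correct:
  "i \<in> correct n \<pi> \<gamma> \<Longrightarrow> next_guess n S \<pi> \<gamma> i = \<gamma> i"
  by (simp add: next_guess_def incorrect_def Let_def)

lemma bij_betw_elt:
  assumes "finite I"
  shows "bij_betw (elt I) {1..card I} I"
proof -
  have "bij_betw (\<lambda>j. j - 1) {1..card I} {..<card I}"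
    by (rule bij_betw_byWitness[where f' = Suc]) auto
  moreover have "bij_betw ((!) (sorted_list_of_set I)) {..<card I} I"
    using assms by (intro bij_betw_nth) auto
  ultimately have "bij_betw ((!) (sorted_list_of_set I) \<circ> (\<lambda>j. j - 1)) {1..card I} I"
    by (rule bij_betw_trans)
  then show ?thesis
    by (simp add: elt_def[abs_def] comp_def)
qed

lemma next_guess_incorrect:
  fixes n :: nat and \<pi> \<gamma> :: "nat \<Rightarrow> nat"
  defines "I \<equiv> incorrect n \<pi> \<gamma>"
  assumes S: "S (card I) permutes {1..card I}" and j: "j \<in> {1..card I}"
  shows "next_guess n S \<pi> \<gamma> (elt I (S (card I) j)) = \<gamma> (elt I j)"
proof -
  have "finite I"
    by (simp add: I_def incorrect_def)
  then have "bij_betw (elt I \<circ> S (card I)) {1..card I} I"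
    using S by (blast intro: bij_betw_trans permutes_imp_bij bij_betw_elt)
  then have bij: "bij_betw (\<lambda>j. elt I (S (card I) j)) {1..card I} I"
    by (simp add: comp_def)
  then have "elt I (S (card I) j) \<in> I"
    using j by (auto simp: bij_betw_def)
  moreover have "the_inv_into {1..card I} (\<lambda>j. elt I (S (card I) j)) (elt I (S (card I) j)) = j"
    using bij j by (intro the_inv_into_f_f[where f = "\<lambda>j. elt I (S (card I) j)"])
      (auto simp: bij_betw_def)
  ultimately show ?thesis
    by (simp add: next_guess_def Let_def flip: I_def)
qed

lemma cyclic_shift_permutes: "cyclic_shift k permutes {1..k}"
proof (rule bij_imp_permutes)
  show "bij_betw (cyclic_shift k) {1..k} {1..k}"
    by (rule bij_betw_byWitness[where f' = "\<lambda>i. if i = 1 then k else i - 1"])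
      (auto simp: cyclic_shift_def)
qed (auto simp: cyclic_shift_def)

lemma CS_in_strategies: "CS n \<in> strategies n"
  by (auto simp: CS_def strategies_def cyclic_shift_permutes[simplified])

end

theory Submission
  imports Defs
begin

text \<open>
  A secret with a fixed point is played identically by both strategies, so only derangements matter.
  For these the second guess is \<open>\<sigma>\<^sup>-\<^sup>1\<close> with \<open>\<sigma> = S[n]\<close>, and the game ends after three guesses
  exactly if \<open>\<pi>\<^sup>-\<^sup>1 = T\<^sub>I \<circ> \<sigma>\<close>, where \<open>I\<close> is the set of wrong positions in the second guess and
  \<open>T\<^sub>I\<close> is \<open>S[|I|]\<close> acting on \<open>I\<close>.  Hence such secrets correspond to the sets \<open>I\<close> with at least two
  elements for which \<open>T\<^sub>I \<circ> \<sigma>\<close> is a derangement.  A proper subset \<open>I\<close> violates this if and only if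
  \<open>i\<close> is the cyclic successor of \<open>\<sigma> i\<close> in \<open>I\<close> for some \<open>i\<close>.  For the cyclic shift only the \<open>n\<close> sets
  \<open>{i, \<sigma> i}\<close> violate it; for any other \<open>n\<close>-cycle these \<open>n\<close> sets do as well, and so does some
  three-element set \<open>{i, \<sigma> i, z}\<close>.
\<close>

section \<open>Permutations of indices carried to a set along its increasing enumeration\<close>

definition transport :: "nat set \<Rightarrow> (nat \<Rightarrow> nat) \<Rightarrow> nat \<Rightarrow> nat" where
  "transport I \<sigma> i = (if i \<in> I then elt I (\<sigma> (the_inv_into {1..card I} (elt I) i)) else i)"

lemma transport_elt:
  assumes "finite I" "j \<in> {1..card I}"
  shows "transport I \<sigma> (elt I j) = elt I (\<sigma> j)"
proof -
  have inj: "inj_on (elt I) {1..card I}" and "elt I j \<in> I"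
    using bij_betw_elt[OF assms(1)] assms(2) by (auto simp: bij_betw_def)
  then show ?thesis
    using the_inv_into_f_f[OF inj assms(2)] by (simp add: transport_def)
qed

lemma elt_cases:
  assumes "finite I" "i \<in> I"
  obtains j where "j \<in> {1..card I}" "i = elt I j"
  using bij_betw_imp_surj_on[OF bij_betw_elt[OF assms(1)]] assms(2) by blast

lemma transport_permutes:
  assumes "finite I" "\<sigma> permutes {1..card I}"
  shows "transport I \<sigma> permutes I"
proof (rule bij_imp_permutes)
  let ?g = "the_inv_into {1..card I} (elt I)"
  have "bij_betw (elt I \<circ> (\<sigma> \<circ> ?g)) I I"
    using assms by (intro bij_betw_trans[of _ _ "{1..card I}"] bij_betw_the_inv_into bij_betw_elt)
      (auto simp: permutes_imp_bij[simplified])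
  then show "bij_betw (transport I \<sigma>) I I"
    by (rule bij_betw_cong[THEN iffD1, rotated]) (simp add: transport_def)
qed (simp add: transport_def)

lemma transport_no_fixpoint:
  assumes "finite I" "\<sigma> permutes {1..card I}" "\<And>j. j \<in> {1..card I} \<Longrightarrow> \<sigma> j \<noteq> j" "i \<in> I"
  shows "transport I \<sigma> i \<noteq> i"
proof -
  obtain j where j: "j \<in> {1..card I}" "i = elt I j"
    using assms by (auto elim: elt_cases)
  moreover have "\<sigma> j \<in> {1..card I}"
    using permutes_in_image[OF assms(2)] j by blast
  ultimately show ?thesis
    using assms bij_betw_elt[OF assms(1)]
    by (auto simp: transport_elt bij_betw_def dest: inj_onD)
qed

lemma elt_interval: "j \<in> {1..n} \<Longrightarrow> elt {1..n} j = j"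
  by (auto simp: elt_def atLeastLessThanSuc_atLeastAtMost[symmetric] simp del: upt_Suc)

text \<open>The enumeration of \<open>{1..n}\<close> is the identity. This is the case of a first
  guess that is wrong everywhere.\<close>

lemma transport_interval:
  assumes "\<sigma> permutes {1..n}"
  shows "transport {1..n} \<sigma> = \<sigma>"
proof
  fix i
  show "transport {1..n} \<sigma> i = \<sigma> i"
  proof (cases "i \<in> {1..n}")
    case True
    then have "\<sigma> i \<in> {1..n}" using permutes_in_image[OF assms] by blast
    then show ?thesis
      using True transport_elt[of "{1..n}" i \<sigma>] by (simp add: elt_interval[simplified])
  next
    case False
    then show ?thesis using assms by (auto simp: transport_def permutes_def)
  qed
qed

section \<open>Guesses as compositions of permutations\<close>

definition advance :: "(nat \<Rightarrow> nat \<Rightarrow> nat) \<Rightarrow> nat set \<Rightarrow> nat \<Rightarrow> nat" where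
  "advance S I = transport I (S (card I))"

lemma strategies_permutes: "S \<in> strategies n \<Longrightarrow> k \<in> {1..n} \<Longrightarrow> S k permutes {1..k}"
  unfolding strategies_def by (drule PiE_mem) auto

lemma advance_permutes:
  assumes "S \<in> strategies n" "I \<subseteq> {1..n}"
  shows "advance S I permutes I"
proof -
  have fin: "finite I" using assms(2) finite_subset by blast
  show ?thesis
  proof (cases "I = {}")
    \<comment> \<open>\<open>strategies\<close> constrains only the indices \<open>1..n\<close>, so
      the empty set is treated apart; there the map is the identity.\<close>
    case True
    then show ?thesis by (auto simp: advance_def transport_def[abs_def] permutes_def)
  next
    case False
    moreover have "card I \<le> n" using card_mono[OF _ assms(2)] by simp
    ultimately have "card I \<in> {1..n}" using fin by (simp add: Suc_le_eq card_gt_0_iff)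
    then have "S (card I) permutes {1..card I}"
      by (rule strategies_permutes[OF assms(1)])
    with fin show ?thesis by (simp add: advance_def transport_permutes[simplified])
  qed
qed

lemma incorrect_subset: "incorrect n \<pi> \<gamma> \<subseteq> {1..n}"
  by (auto simp: incorrect_def)

text \<open>The value guessed at a wrong position \<open>i\<close> moves to position
  \<open>advance S I i\<close>, where \<open>I\<close> is the set of wrong positions; all other
  positions keep their values.\<close>

lemma next_guess_advance:
  assumes "S \<in> strategies n"
  shows "next_guess n S \<pi> \<gamma> \<circ> advance S (incorrect n \<pi> \<gamma>) = \<gamma>"
proof
  fix i
  let ?I = "incorrect n \<pi> \<gamma>"
  have fin: "finite ?I" by (simp add: incorrect_def)
  show "(next_guess n S \<pi> \<gamma> \<circ> advance S ?I) i = \<gamma> i"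
  proof (cases "i \<in> ?I")
    case True
    then obtain j where j: "j \<in> {1..card ?I}" "i = elt ?I j"
      using fin by (auto elim: elt_cases)
    have "card ?I \<le> n" using card_mono[OF _ incorrect_subset[of n \<pi> \<gamma>]] by simp
    then have "card ?I \<in> {1..n}" using j by simp
    then have "S (card ?I) permutes {1..card ?I}"
      by (rule strategies_permutes[OF assms])
    then show ?thesis
      using next_guess_incorrect[of S n \<pi> \<gamma> j] j
      by (simp add: advance_def transport_elt[OF fin, simplified])
  next
    case False
    then show ?thesis by (simp add: advance_def transport_def next_guess_def Let_def)
  qed
qed

lemma next_guess_eq_inv:
  assumes "S \<in> strategies n"
  shows "next_guess n S \<pi> \<gamma> = \<gamma> \<circ> inv (advance S (incorrect n \<pi> \<gamma>))"
proof -
  let ?T = "advance S (incorrect n \<pi> \<gamma>)"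
  have "next_guess n S \<pi> \<gamma> = next_guess n S \<pi> \<gamma> \<circ> ?T \<circ> inv ?T"
    using permutes_inv_o(1)[OF advance_permutes[OF assms incorrect_subset]] by (simp add: comp_assoc)
  then show ?thesis
    using next_guess_advance[OF assms, of \<pi> \<gamma>] by simp
qed

section \<open>Derangements for which the game ends after three guesses\<close>

lemma correct_eq_interval_iff:
  assumes "\<pi> permutes {1..n}" "\<gamma> permutes {1..n}"
  shows "correct n \<pi> \<gamma> = {1..n} \<longleftrightarrow> \<gamma> = \<pi>"
proof
  assume eq: "correct n \<pi> \<gamma> = {1..n}"
  show "\<gamma> = \<pi>"
  proof
    fix i
    show "\<gamma> i = \<pi> i"
    proof (cases "i \<in> {1..n}")
      case True
      then show ?thesis unfolding eq[symmetric] by (simp add: correct_def)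
    next
      case False
      show ?thesis
        unfolding permutes_not_in[OF assms(1) False] permutes_not_in[OF assms(2) False] ..
    qed
  qed
qed (auto simp: correct_def)

lemma guess_2: "guess n S \<pi> 2 = next_guess n S \<pi> id"
  by (simp add: numeral_2_eq_2)

lemma guess_3: "guess n S \<pi> 3 = next_guess n S \<pi> (next_guess n S \<pi> id)"
  by (simp add: numeral_3_eq_3)

lemma ends_after_3:
  "ends_after n S \<pi> 3 \<longleftrightarrow> correct n \<pi> (next_guess n S \<pi> (next_guess n S \<pi> id)) = {1..n}
     \<and> correct n \<pi> id \<noteq> {1..n} \<and> correct n \<pi> (next_guess n S \<pi> id) \<noteq> {1..n}"
proof -
  have "{1..<3::nat} = {1, 2}" by auto
  then show ?thesis unfolding ends_after_def by (simp add: guess_2 guess_3)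
qed

text \<open>Every position of the first guess is wrong, so the second guess is
  \<open>inv (S n)\<close> and the right-hand side of the equation is the third. The equation is
  implicit in \<open>\<pi>\<close>, which also determines the set of wrong positions.\<close>

lemma derangement_ends_after_3:
  assumes S: "S \<in> strategies n" and \<pi>: "\<pi> permutes {1..n}" and n: "n \<ge> 1"
    and der: "\<forall>i\<in>{1..n}. \<pi> i \<noteq> i"
  shows "ends_after n S \<pi> 3 \<longleftrightarrow>
    inv (S n) \<noteq> \<pi> \<and> \<pi> = inv (S n) \<circ> inv (advance S {i\<in>{1..n}. inv (S n) i \<noteq> \<pi> i})"
proof -
  have Sn: "S n permutes {1..n}"
    using strategies_permutes[OF S, of n] n by simp
  have "incorrect n \<pi> id = {1..n}"
    using der by (force simp: incorrect_def correct_def)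
  then have g2: "next_guess n S \<pi> id = inv (S n)"
    using next_guess_eq_inv[OF S, of \<pi> id] transport_interval[OF Sn] by (simp add: advance_def)
  let ?I = "incorrect n \<pi> (inv (S n))"
  have I: "?I = {i\<in>{1..n}. inv (S n) i \<noteq> \<pi> i}"
    by (auto simp: incorrect_def correct_def)
  have inv: "inv (S n) permutes {1..n}"
    using Sn by (rule permutes_inv)
  have "advance S ?I permutes {1..n}"
    using advance_permutes[OF S incorrect_subset] incorrect_subset by (rule permutes_subset)
  then have g3: "inv (S n) \<circ> inv (advance S ?I) permutes {1..n}"
    using inv by (intro permutes_compose) (rule permutes_inv)
  have "correct n \<pi> id \<noteq> {1..n}"
    using der n by (force simp: correct_def)
  then show ?thesis
    unfolding ends_after_3 g2 next_guess_eq_inv[OF S, of \<pi> "inv (S n)"]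
      correct_eq_interval_iff[OF \<pi> inv] correct_eq_interval_iff[OF \<pi> g3] I[symmetric]
    by metis
qed

text \<open>Lengths start at 2 because the only permutation of \<open>{1..1}\<close> has a fixed
  point.\<close>

definition fixpoint_free :: "nat \<Rightarrow> (nat \<Rightarrow> nat \<Rightarrow> nat) \<Rightarrow> bool" where
  "fixpoint_free n S \<longleftrightarrow> (\<forall>k\<in>{2..n}. \<forall>j\<in>{1..k}. S k j \<noteq> j)"

text \<open>Makes \<open>I\<close> recoverable from \<open>advance S I\<close> as the set of points
  that it moves.\<close>

lemma advance_eq_iff:
  assumes "S \<in> strategies n" "fixpoint_free n S" "I \<subseteq> {1..n}" "card I \<ge> 2"
  shows "advance S I i = i \<longleftrightarrow> i \<notin> I"
proof -
  have "card I \<le> n" using card_mono[OF _ assms(3)] by simp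
  then have k: "card I \<in> {2..n}" using assms by simp
  then have "S (card I) permutes {1..card I}"
    using strategies_permutes[OF assms(1), of "card I"] by simp
  then have "i \<in> I \<Longrightarrow> transport I (S (card I)) i \<noteq> i"
    using k assms by (intro transport_no_fixpoint)
      (auto simp: fixpoint_free_def intro: finite_subset)
  then show ?thesis by (auto simp: advance_def transport_def)
qed

definition good_sets :: "nat \<Rightarrow> (nat \<Rightarrow> nat \<Rightarrow> nat) \<Rightarrow> nat set set" where
  "good_sets n S = {I. I \<subseteq> {1..n} \<and> 2 \<le> card I \<and> (\<forall>i\<in>{1..n}. advance S I (S n i) \<noteq> i)}"

definition bad_sets :: "nat \<Rightarrow> (nat \<Rightarrow> nat \<Rightarrow> nat) \<Rightarrow> nat set set" where
  "bad_sets n S = {I. I \<subseteq> {1..n} \<and> 2 \<le> card I \<and> (\<exists>i\<in>{1..n}. advance S I (S n i) = i)}"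

lemma card_derangements_ends_after_3:
  assumes S: "S \<in> strategies n" "fixpoint_free n S" and n: "n \<ge> 2"
  shows "card {\<pi>. \<pi> permutes {1..n} \<and> (\<forall>i\<in>{1..n}. \<pi> i \<noteq> i) \<and> ends_after n S \<pi> 3} =
    card (good_sets n S)"
proof -
  let ?\<sigma> = "S n"
  have Sn: "?\<sigma> permutes {1..n}"
    using strategies_permutes[OF S(1), of n] n by simp
  \<comment> \<open>\<open>f I\<close> is the third guess if \<open>I\<close> is the set of wrong
    positions in the second; \<open>g \<pi>\<close> is that set for the secret \<open>\<pi>\<close>.
    The two maps are shown to be mutually inverse.\<close>
  define f where "f I = inv ?\<sigma> \<circ> inv (advance S I)" for I
  define g where "g \<pi> = {i\<in>{1..n}. inv ?\<sigma> i \<noteq> \<pi> i}" for \<pi> :: "nat \<Rightarrow> nat"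
  have adv: "advance S I permutes {1..n}" if "I \<subseteq> {1..n}" for I
    using advance_permutes[OF S(1) that] that by (rule permutes_subset)
  \<comment> \<open>\<open>f I\<close> is the inverse of
    \<open>advance S I \<circ> ?\<sigma>\<close>, and a permutation has the same fixed points as its
    inverse.\<close>
  have der: "(\<forall>i\<in>{1..n}. f I i \<noteq> i) \<longleftrightarrow> (\<forall>i\<in>{1..n}. advance S I (?\<sigma> i) \<noteq> i)"
    if "I \<subseteq> {1..n}" for I
  proof -
    have "f I i = i \<longleftrightarrow> advance S I (?\<sigma> i) = i" for i
      using permutes_inv_eq[OF Sn, of "inv (advance S I) i" i]
        permutes_inv_eq[OF adv[OF that], of i "?\<sigma> i"]
      by (simp add: f_def eq_commute)
    then show ?thesis by simp
  qed
  \<comment> \<open>Cancelling the injective \<open>inv ?\<sigma>\<close>, the second guess and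
    \<open>f I\<close> differ exactly at the points moved by \<open>advance S I\<close>.\<close>
  have gf: "g (f I) = I" if "I \<subseteq> {1..n}" "2 \<le> card I" for I
  proof -
    have "inv ?\<sigma> i = f I i \<longleftrightarrow> advance S I i = i" for i
      using permutes_inv_eq[OF adv[OF that(1)], of i i] inj_eq[OF permutes_inj[OF permutes_inv[OF Sn]]]
      by (simp add: f_def eq_commute)
    then show ?thesis
      using advance_eq_iff[OF S that] that by (auto simp: g_def)
  qed
  have perm: "f I permutes {1..n}" if "I \<subseteq> {1..n}" for I
    unfolding f_def using Sn adv[OF that] by (intro permutes_compose permutes_inv)
  have "bij_betw f (good_sets n S)
    {\<pi>. \<pi> permutes {1..n} \<and> (\<forall>i\<in>{1..n}. \<pi> i \<noteq> i) \<and> ends_after n S \<pi> 3}"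
    (is "bij_betw f ?A ?B")
  proof (rule bij_betw_byWitness[where f' = g])
    show "\<forall>I\<in>?A. g (f I) = I"
      by (auto simp: good_sets_def gf)
    have B: "inv ?\<sigma> \<noteq> \<pi>" "\<pi> = f (g \<pi>)" if "\<pi> \<in> ?B" for \<pi>
      using derangement_ends_after_3[OF S(1), of \<pi>] that n by (auto simp: f_def g_def)
    then show "\<forall>\<pi>\<in>?B. f (g \<pi>) = \<pi>" by simp
    show "f ` ?A \<subseteq> ?B"
    proof
      fix \<pi> assume "\<pi> \<in> f ` ?A"
      then obtain I where I: "I \<in> ?A" "\<pi> = f I" by auto
      then have sub: "I \<subseteq> {1..n}" "2 \<le> card I" by (auto simp: good_sets_def)
      have "I \<noteq> {}" using sub by auto
      then have "inv ?\<sigma> \<noteq> \<pi>" using gf[OF sub] I by (auto simp: g_def)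
      moreover have "\<pi> permutes {1..n}" using I perm[OF sub(1)] by simp
      moreover have "\<forall>i\<in>{1..n}. \<pi> i \<noteq> i"
        using I der[OF sub(1)] by (simp add: good_sets_def)
      moreover have "\<pi> = f (g \<pi>)" using I gf[OF sub] by simp
      ultimately show "\<pi> \<in> ?B"
        using derangement_ends_after_3[OF S(1), of \<pi>] n by (simp add: f_def g_def)
    qed
    show "g ` ?B \<subseteq> ?A"
    proof
      fix I assume "I \<in> g ` ?B"
      then obtain \<pi> where \<pi>: "\<pi> \<in> ?B" "I = g \<pi>" by auto
      have sub: "I \<subseteq> {1..n}" using \<pi> by (auto simp: g_def)
      have fI: "\<pi> = f I" using B[OF \<pi>(1)] \<pi> by simp
      \<comment> \<open>With at most one wrong position \<open>advance S I\<close> would be the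
        identity, and the second guess would already equal the secret.\<close>
      have "2 \<le> card I"
      proof -
        have "\<not> (\<exists>x. I \<subseteq> {x})"
        proof
          assume "\<exists>x. I \<subseteq> {x}"
          then obtain x where "I \<subseteq> {x}" by blast
          then have "advance S I permutes {x}"
            using advance_permutes[OF S(1) sub] permutes_subset by blast
          then have "advance S I = id" by (simp add: permutes_sing)
          then show False using fI B[OF \<pi>(1)] by (simp add: f_def)
        qed
        moreover have "finite I" using finite_subset[OF sub] by simp
        ultimately have "card I \<noteq> 0" "card I \<noteq> 1"
          by (auto simp: card_1_singleton_iff)
        then show ?thesis by linarith
      qed
      moreover have "\<forall>i\<in>{1..n}. f I i \<noteq> i"
        using \<pi>(1) unfolding fI[symmetric] by blast
      ultimately show "I \<in> ?A"
        unfolding good_sets_def der[OF sub] using sub by blast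
    qed
  qed
  then show ?thesis by (simp add: bij_betw_same_card)
qed

text \<open>The total does not depend on \<open>S\<close>, so more bad sets means fewer good
  ones.\<close>

lemma card_good_bad_sets:
  "card (good_sets n S) + card (bad_sets n S) = card {I. I \<subseteq> {1..n} \<and> 2 \<le> card I}"
proof -
  have "{I. I \<subseteq> {1..n} \<and> 2 \<le> card I} = good_sets n S \<union> bad_sets n S"
    by (auto simp: good_sets_def bad_sets_def)
  moreover have "good_sets n S \<inter> bad_sets n S = {}" "finite (good_sets n S)" "finite (bad_sets n S)"
    by (auto simp: good_sets_def bad_sets_def)
  ultimately show ?thesis by (metis card_Un_disjoint)
qed

section \<open>Cyclic successors within a set\<close>

text \<open>\<open>y\<close> is the first element of \<open>I\<close> met when walking cyclically upwards from \<open>x\<close>.\<close>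

definition next_in :: "nat set \<Rightarrow> nat \<Rightarrow> nat \<Rightarrow> bool" where
  "next_in I x y \<longleftrightarrow>
     x < y \<and> (\<forall>z\<in>I. z \<le> x \<or> y \<le> z) \<or> y \<le> x \<and> (\<forall>z\<in>I. y \<le> z \<and> z \<le> x)"

lemma next_in_unique: "next_in I x y \<Longrightarrow> next_in I x y' \<Longrightarrow> y \<in> I \<Longrightarrow> y' \<in> I \<Longrightarrow> y = y'"
  unfolding next_in_def by (meson le_antisym linorder_not_le)

lemma elt_mono:
  assumes "1 \<le> i" "i \<le> j" "j \<le> card I"
  shows "elt I i \<le> elt I j"
  using assms unfolding elt_def by (intro sorted_nth_mono) auto

lemma elt_strict_mono:
  assumes "finite I" "1 \<le> i" "i < j" "j \<le> card I"
  shows "elt I i < elt I j"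
proof -
  have "elt I i \<noteq> elt I j"
    using assms bij_betw_elt[OF assms(1)] by (auto simp: bij_betw_def dest!: inj_onD)
  then show ?thesis using elt_mono[of i j I] assms by simp
qed

text \<open>No element of \<open>I\<close> lies strictly between the ones with indices
  \<open>j\<close> and \<open>Suc j\<close>; the last index wraps round to the minimum of
  \<open>I\<close>.\<close>

lemma next_in_transport_cyclic_shift:
  assumes "finite I" "x \<in> I"
  shows "next_in I x (transport I (cyclic_shift (card I)) x)"
proof -
  obtain j where j: "j \<in> {1..card I}" "x = elt I j"
    using assms by (auto elim: elt_cases)
  have T: "transport I (cyclic_shift (card I)) x = elt I (cyclic_shift (card I) j)"
    using j assms transport_elt by simp
  show ?thesis
  proof (cases "j < card I")
    case True
    then have T: "transport I (cyclic_shift (card I)) x = elt I (Suc j)"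
      using T j by (simp add: cyclic_shift_def)
    have "z \<le> x \<or> elt I (Suc j) \<le> z" if z: "z \<in> I" for z
    proof -
      obtain l where l: "l \<in> {1..card I}" "z = elt I l"
        using assms z by (auto elim: elt_cases)
      show ?thesis using j l True elt_mono[of l j I] elt_mono[of "Suc j" l I]
        by (cases "l \<le> j") auto
    qed
    then show ?thesis using T j True elt_strict_mono[OF assms(1), of j "Suc j"]
      by (auto simp: next_in_def)
  next
    case False
    then have T: "transport I (cyclic_shift (card I)) x = elt I 1" and jk: "j = card I"
      using T j by (auto simp: cyclic_shift_def)
    have "elt I 1 \<le> z \<and> z \<le> x" if z: "z \<in> I" for z
    proof -
      obtain l where l: "l \<in> {1..card I}" "z = elt I l"
        using assms z by (auto elim: elt_cases)
      show ?thesis using j l jk elt_mono[of l j I] elt_mono[of 1 l I] by auto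
    qed
    then show ?thesis using T assms by (auto simp: next_in_def)
  qed
qed

text \<open>Replaces the shift by a pure order condition; the converse direction holds because the
  next element is unique.\<close>

lemma transport_cyclic_shift_eq_iff:
  assumes "finite I" "x \<in> I" "y \<in> I"
  shows "transport I (cyclic_shift (card I)) x = y \<longleftrightarrow> next_in I x y"
proof -
  have "transport I (cyclic_shift (card I)) x \<in> I"
    using transport_permutes[OF assms(1) cyclic_shift_permutes] assms(2)
    by (simp add: permutes_in_image)
  then show ?thesis
    using next_in_transport_cyclic_shift[OF assms(1,2)] next_in_unique assms(3) by blast
qed

section \<open>Bad sets of the cyclic shift\<close>

lemma fixpoint_free_CS: "fixpoint_free n (CS n)"
  by (auto simp: fixpoint_free_def CS_def cyclic_shift_def)

text \<open>The cyclic walk upwards from the successor of \<open>i\<close> to \<open>i\<close> meets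
  every position. If no other element of \<open>I\<close> is met on the way, then \<open>I\<close>
  is just the pair of its endpoints, and there are at most \<open>n\<close> such pairs.\<close>

lemma card_bad_sets_CS:
  assumes "n \<ge> 2"
  shows "card (bad_sets n (CS n)) \<le> n"
proof -
  have "bad_sets n (CS n) \<subseteq> (\<lambda>i. {i, cyclic_shift n i}) ` {1..n}"
  proof
    fix I assume "I \<in> bad_sets n (CS n)"
    then obtain i where I: "I \<subseteq> {1..n}" "2 \<le> card I" "i \<in> {1..n}"
      and adv: "advance (CS n) I (CS n n i) = i" by (auto simp: bad_sets_def)
    have fin: "finite I" using I finite_subset by blast
    have "card I \<le> n" using card_mono[OF _ I(1)] by simp
    then have CSI: "CS n (card I) = cyclic_shift (card I)" using I by (simp add: CS_def)
    let ?x = "cyclic_shift n i"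
    have x: "CS n n i = ?x" using assms by (simp add: CS_def)
    have ne: "?x \<noteq> i" using I assms by (auto simp: cyclic_shift_def)
    \<comment> \<open>\<open>advance\<close> moves \<open>?x\<close> to \<open>i\<close>, and it
      moves only elements of \<open>I\<close>, within \<open>I\<close>.\<close>
    then have xI: "?x \<in> I"
      using adv advance_eq_iff[OF CS_in_strategies fixpoint_free_CS I(1,2)] x by metis
    then have iI: "i \<in> I"
      using adv permutes_in_image[OF advance_permutes[OF CS_in_strategies I(1)]] x by metis
    have "next_in I ?x i"
      using adv transport_cyclic_shift_eq_iff[OF fin xI iI] x CSI by (simp add: advance_def)
    then have "\<forall>z\<in>I. z = i \<or> z = ?x"
      using I assms by (fastforce simp: next_in_def cyclic_shift_def split: if_splits)
    then have "I = {i, ?x}" using xI iI by auto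
    then show "I \<in> (\<lambda>i. {i, cyclic_shift n i}) ` {1..n}" using I by auto
  qed
  then have "card (bad_sets n (CS n)) \<le> card {1..n}"
    using surj_card_le by blast
  then show ?thesis by simp
qed

section \<open>Bad sets of the other inductive strategies\<close>

lemma cyclic_on_no_short_cycle:
  assumes "cyclic_on f A" "x \<in> A" "card A \<ge> 3"
  shows "f x \<noteq> x" "f (f x) \<noteq> x"
proof -
  have A: "orbit f x = A" using assms orbit_cyclic_eq3 by metis
  show 2: "f (f x) \<noteq> x"
  proof
    assume ffx: "f (f x) = x"
    \<comment> \<open>A return after two steps would confine the orbit, which is all of
      \<open>A\<close>, to two points.\<close>
    have "y \<in> {x, f x}" if "y \<in> orbit f x" for y
      using that by induction (use ffx in auto)
    then have "A \<subseteq> {x, f x}" using A by auto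
    then have "card A \<le> card {x, f x}" by (intro card_mono) auto
    also have "\<dots> \<le> 2" by (simp add: card_insert_if)
    finally show False using assms by simp
  qed
  then show "f x \<noteq> x" by auto
qed

lemma inductive_strategy_eq_CS:
  assumes "inductive_strategy n S" "k < n"
  shows "S k = CS n k"
proof (cases "k = 0")
  \<comment> \<open>Both strategies are \<open>undefined\<close> at 0, the length looked up when
    nothing is wrong.\<close>
  case True
  then show ?thesis
    using assms PiE_arb[of S "{1..n}" _ 0] by (auto simp: inductive_strategy_def strategies_def CS_def)
next
  case False
  then show ?thesis using assms by (auto simp: inductive_strategy_def)
qed

lemma fixpoint_free_inductive:
  assumes "inductive_strategy n S" "n \<ge> 3"
  shows "fixpoint_free n S"
proof -
  have "S k j \<noteq> j" if "k \<in> {2..n}" "j \<in> {1..k}" for k j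
  proof (cases "k < n")
    case True
    then show ?thesis
      using fixpoint_free_CS[of n] that inductive_strategy_eq_CS[OF assms(1), of k]
      by (simp add: fixpoint_free_def)
  next
    case False
    then show ?thesis
      using cyclic_on_no_short_cycle(1)[of "S n" "{1..n}" j] that assms
      by (auto simp: inductive_strategy_def)
  qed
  then show ?thesis by (auto simp: fixpoint_free_def)
qed

text \<open>For a proper subset the next move is a cyclic shift, so badness depends only on the
  order of \<open>I\<close>, whatever cycle \<open>S n\<close> is.\<close>

lemma bad_setI:
  assumes "inductive_strategy n S" "I \<subseteq> {1..n}" "2 \<le> card I" "card I < n"
    "i \<in> I" "S n i \<in> I" "next_in I (S n i) i"
  shows "I \<in> bad_sets n S"
proof -
  have fin: "finite I" using assms(2) finite_subset by blast
  have "S (card I) = cyclic_shift (card I)"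
    using inductive_strategy_eq_CS[OF assms(1,4)] assms(3,4) by (simp add: CS_def)
  then have "advance S I (S n i) = i"
    using transport_cyclic_shift_eq_iff[OF fin assms(6,5)] assms(7) by (simp add: advance_def)
  then show ?thesis using assms by (auto simp: bad_sets_def)
qed

lemma card_bad_sets_inductive:
  assumes S: "inductive_strategy n S" "S \<noteq> CS n" and n: "n \<ge> 4"
  shows "card (bad_sets n S) > n"
proof -
  let ?\<sigma> = "S n"
  have strat: "S \<in> strategies n" and cyc: "cyclic_on ?\<sigma> {1..n}"
    using S by (auto simp: inductive_strategy_def)
  have Sn: "?\<sigma> permutes {1..n}"
    using strategies_permutes[OF strat, of n] n by simp
  have \<sigma>_in: "?\<sigma> i \<in> {1..n}" if "i \<in> {1..n}" for i
    using permutes_in_image[OF Sn] that by blast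
  have \<sigma>: "?\<sigma> i \<noteq> i" "?\<sigma> (?\<sigma> i) \<noteq> i" if "i \<in> {1..n}" for i
    using cyclic_on_no_short_cycle[OF cyc that] n by auto
  define P where "P = (\<lambda>i. {i, ?\<sigma> i}) ` {1..n}"
  \<comment> \<open>If two different points gave the same pair, \<open>?\<sigma>\<close> would swap
    them, but it has no 2-cycle.\<close>
  have "inj_on (\<lambda>i. {i, ?\<sigma> i}) {1..n}"
    using \<sigma> by (intro inj_onI) (metis doubleton_eq_iff)
  then have cardP: "card P = n" by (simp add: P_def card_image)
  have cardP2: "card I = 2" if "I \<in> P" for I
    using that \<sigma>(1) by (fastforce simp: P_def card_insert_if)
  have "P \<subseteq> bad_sets n S"
  proof
    fix I assume "I \<in> P"
    then obtain i where i: "i \<in> {1..n}" "I = {i, ?\<sigma> i}" by (auto simp: P_def)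
    \<comment> \<open>In a two-element set each element is the cyclic successor of the
      other.\<close>
    then have "next_in I (?\<sigma> i) i" by (auto simp: next_in_def)
    then show "I \<in> bad_sets n S"
      using i \<sigma>_in[OF i(1)] cardP2[OF \<open>I \<in> P\<close>] n by (intro bad_setI[OF S(1), of I i]) auto
  qed
  moreover obtain I where "I \<in> bad_sets n S" "card I = 3"
  proof -
    have "\<exists>i\<in>{1..n}. ?\<sigma> i \<noteq> cyclic_shift n i"
    proof (rule ccontr)
      assume "\<not> ?thesis"
      then have "?\<sigma> i = cyclic_shift n i" for i
        using permutes_not_in[OF Sn, of i] permutes_not_in[OF cyclic_shift_permutes, of i n]
        by (cases "i \<in> {1..n}") (blast, simp)
      then have "?\<sigma> = cyclic_shift n" by (rule ext)
      then have "?\<sigma> = CS n n" using n by (simp add: CS_def)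
      moreover have "S k = CS n k" if "k > n" for k
        using strat that PiE_arb[of S "{1..n}" _ k] by (auto simp: strategies_def CS_def)
      ultimately have "S k = CS n k" for k
        using inductive_strategy_eq_CS[OF S(1)] by (metis linorder_neqE_nat)
      then show False using S(2) by auto
    qed
    then obtain i where i: "i \<in> {1..n}" "?\<sigma> i \<noteq> cyclic_shift n i" by blast
    let ?x = "?\<sigma> i"
    have x: "?x \<in> {1..n}" "?x \<noteq> i" using \<sigma>_in \<sigma> i by auto
    \<comment> \<open>The point \<open>z\<close> must lie off the upward walk from \<open>?x\<close>
      to \<open>i\<close>, that is, strictly between \<open>i\<close> and \<open>?x\<close>
      cyclically. There is room since \<open>?x\<close> is not the cyclic successor of
      \<open>i\<close>. If \<open>?x < i\<close>, one of 1 and \<open>n\<close> serves, as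
      \<open>?x = 1\<close> with \<open>i = n\<close> is the excluded wrap-around; otherwise
      \<open>i + 1\<close> does.\<close>
    have "\<exists>z\<in>{1..n}. z \<noteq> i \<and> z \<noteq> ?x \<and> next_in {i, ?x, z} ?x i"
    proof (cases "?x < i")
      case True
      have "?x \<noteq> 1 \<or> i \<noteq> n" using i by (auto simp: cyclic_shift_def)
      then show ?thesis
      proof
        assume "?x \<noteq> 1"
        then show ?thesis using True x by (intro bexI[of _ 1]) (auto simp: next_in_def)
      next
        assume "i \<noteq> n"
        then show ?thesis using True i x by (intro bexI[of _ n]) (auto simp: next_in_def)
      qed
    next
      case False
      then have "i + 1 < ?x" using i x by (auto simp: cyclic_shift_def split: if_splits)
      then show ?thesis using x by (intro bexI[of _ "i + 1"]) (auto simp: next_in_def)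
    qed
    then obtain z where z: "z \<in> {1..n}" "z \<noteq> i" "z \<noteq> ?x" "next_in {i, ?x, z} ?x i" by blast
    then have "card {i, ?x, z} = 3" using x by auto
    \<comment> \<open>Since \<open>n \<ge> 4\<close>, a three-element set is proper, so the move on
      it is a cyclic shift.\<close>
    moreover from this have "{i, ?x, z} \<in> bad_sets n S"
      using i x z n by (intro bad_setI[OF S(1), of _ i]) auto
    ultimately show ?thesis using that by blast
  qed
  moreover from this have "I \<notin> P" using cardP2 by fastforce
  moreover have fin: "finite (bad_sets n S)" by (auto simp: bad_sets_def)
  ultimately have "P \<subset> bad_sets n S" by blast
  then show ?thesis using psubset_card_mono[OF fin, of P] cardP by simp
qed

section \<open>Secrets with a fixed point, and the final count\<close>

lemma next_guess_cong:
  assumes "S (card (incorrect n \<pi> \<gamma>)) = S' (card (incorrect n \<pi> \<gamma>))"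
  shows "next_guess n S \<pi> \<gamma> = next_guess n S' \<pi> \<gamma>"
  using assms by (simp add: next_guess_def fun_eq_iff Let_def)

lemma incorrect_next_guess: "incorrect n \<pi> (next_guess n S \<pi> \<gamma>) \<subseteq> incorrect n \<pi> \<gamma>"
proof -
  have "correct n \<pi> \<gamma> \<subseteq> correct n \<pi> (next_guess n S \<pi> \<gamma>)"
    using next_guess_correct[of _ n \<pi> \<gamma> S] by (auto simp: correct_def)
  then show ?thesis by (auto simp: incorrect_def)
qed

text \<open>The fixed point is right in the first guess and stays right. Hence fewer than
  \<open>n\<close> positions are ever wrong, and the two strategies agree on all such
  lengths.\<close>

lemma ends_after_3_fixpoint:
  assumes S: "inductive_strategy n S" and i: "i \<in> {1..n}" "\<pi> i = i"
  shows "ends_after n S \<pi> 3 \<longleftrightarrow> ends_after n (CS n) \<pi> 3"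
proof -
  have eq: "next_guess n S \<pi> \<gamma> = next_guess n (CS n) \<pi> \<gamma>" if "i \<notin> incorrect n \<pi> \<gamma>" for \<gamma>
  proof -
    have "incorrect n \<pi> \<gamma> \<subset> {1..n}" using incorrect_subset[of n \<pi> \<gamma>] i that by blast
    then have "card (incorrect n \<pi> \<gamma>) < n" using psubset_card_mono[of "{1..n}" "incorrect n \<pi> \<gamma>"] by simp
    then show ?thesis using inductive_strategy_eq_CS[OF S] by (intro next_guess_cong) simp
  qed
  have "i \<notin> incorrect n \<pi> id" using i by (simp add: incorrect_def correct_def)
  moreover from this have "i \<notin> incorrect n \<pi> (next_guess n (CS n) \<pi> id)"
    using incorrect_next_guess by blast
  ultimately show ?thesis by (simp add: ends_after_3 eq)
qed

lemma game_gf_split: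
  "fps_nth (game_gf n S) r =
     card {\<pi>. \<pi> permutes {1..n} \<and> (\<exists>i\<in>{1..n}. \<pi> i = i) \<and> ends_after n S \<pi> r} +
     card {\<pi>. \<pi> permutes {1..n} \<and> (\<forall>i\<in>{1..n}. \<pi> i \<noteq> i) \<and> ends_after n S \<pi> r}"
proof -
  have "finite {\<pi>. \<pi> permutes {1..n}}" by (rule finite_permutations) simp
  then show ?thesis
    unfolding game_gf_def fps_nth_Abs_fps
    by (subst card_Un_disjoint[symmetric])
      (auto elim!: finite_subset[rotated] intro!: arg_cong[where f = card])
qed

theorem theorem4p3:
  fixes n :: nat and S :: "nat \<Rightarrow> nat \<Rightarrow> nat"
  assumes "n \<ge> 4" and "inductive_strategy n S" and "S \<noteq> CS n"
  shows "fps_nth (game_gf n (CS n)) 3 > fps_nth (game_gf n S) 3"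
proof -
  have strat: "S \<in> strategies n" using assms(2) by (simp add: inductive_strategy_def)
  have "{\<pi>. \<pi> permutes {1..n} \<and> (\<exists>i\<in>{1..n}. \<pi> i = i) \<and> ends_after n S \<pi> 3} =
      {\<pi>. \<pi> permutes {1..n} \<and> (\<exists>i\<in>{1..n}. \<pi> i = i) \<and> ends_after n (CS n) \<pi> 3}"
    using ends_after_3_fixpoint[OF assms(2)] by blast
  \<comment> \<open>The cyclic shift has at most \<open>n\<close> bad sets and \<open>S\<close> has
    more than \<open>n\<close>, out of the same total.\<close>
  moreover have "card (good_sets n S) < card (good_sets n (CS n))"
    using card_good_bad_sets[of n S] card_good_bad_sets[of n "CS n"]
      card_bad_sets_CS[of n] card_bad_sets_inductive[OF assms(2,3,1)] assms(1) by simp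
  ultimately show ?thesis
    using card_derangements_ends_after_3[OF strat fixpoint_free_inductive[OF assms(2)]]
      card_derangements_ends_after_3[OF CS_in_strategies fixpoint_free_CS, of n] assms(1)
    by (simp add: game_gf_split)
qed

end
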